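(* Let $a,b,c,d,p,q$ be integers satisfying $$(4q^2-p^2)b^2+(4p^2-q^2)a^2=15c^2\quad\text{and}\quad (4p^2-q^2)b^2+(4q^2-p^2)a^2=15d^2 .$$ Then for each $k\in\{1,3,5,7\}$, $$(-c+d+ap-bq)^k+(-c+d-ap+bq)^k+(-2c-bp-aq)^k+(-2c+bp+aq)^k+(-c-d-ap+bq)^k+(-c-d+ap-bq)^k$$ $$=(-c+d+ap+bq)^k+(-c+d-ap-bq)^k+(-2c-bp+aq)^k+(-2c+bp-aq)^k+(-c-d-ap-bq)^k+(-c-d+ap+bq)^k .$$ *)

theory Defs
  imports Main
begin

end

theory Submission
  imports Defs
begin

text \<open>
  The theorem is an instance of a polynomial identity in fewer parameters.  With
  \<open>u = d - c\<close> and \<open>w = - c - d\<close> the three centres are \<open>u\<close>, \<open>u + w = - 2 * c\<close> and \<open>w\<close>, and each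
  side consists of pairs \<open>u \<plusminus> x\<close>, \<open>(u + w) \<plusminus> y\<close>, \<open>w \<plusminus> x\<close>.  A sum \<open>(u + x)^k + (u - x)^k\<close> is even in
  \<open>x\<close>, so only the squares of the offsets matter.  The left side has \<open>x = a * p - b * q\<close> and
  \<open>y = b * p + a * q\<close>, the right side has \<open>x' = a * p + b * q\<close> and \<open>y' = b * p - a * q\<close>; by the
  two-squares identity both have \<open>x\<^sup>2 + y\<^sup>2 = (a\<^sup>2 + b\<^sup>2) * (p\<^sup>2 + q\<^sup>2)\<close>.

  The difference of the two assumptions says \<open>x'\<^sup>2 - y\<^sup>2 = 3 * u * w\<close>, and their sum says
  \<open>2 * (x\<^sup>2 + y\<^sup>2) = 5 * (u\<^sup>2 + w\<^sup>2)\<close>.  For \<open>k = 1\<close> and \<open>k = 3\<close> the two sides agree because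
  \<open>x\<^sup>2 + y\<^sup>2\<close> does; for \<open>k = 5\<close> the first relation is what is needed.  For \<open>k = 7\<close> the first
  relation turns the difference of the sides into a multiple of
  \<open>5 * (u\<^sup>2 + w\<^sup>2) - 2 * (x\<^sup>2 + y\<^sup>2)\<close>, which the second relation makes zero.
\<close>

lemma plus_minus_odd_powers:
  fixes u x :: "'a::comm_ring_1"
  shows "(u + x)^3 + (u - x)^3 = 2 * (u^3 + 3 * u * x^2)"
    and "(u + x)^5 + (u - x)^5 = 2 * (u^5 + 10 * u^3 * x^2 + 5 * u * (x^2)^2)"
    and "(u + x)^7 + (u - x)^7 = 2 * (u^7 + 21 * u^5 * x^2 + 35 * u^3 * (x^2)^2 + 7 * u * (x^2)^3)"
  by (simp_all add: algebra_simps eval_nat_numeral)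

text \<open>
  Writing \<open>P\<close> and \<open>Q\<close> for \<open>x\<^sup>2\<close> and \<open>y\<^sup>2\<close>, the first two assumptions replace \<open>x'\<^sup>2\<close> by
  \<open>Q + 3 * u * w\<close> and \<open>y'\<^sup>2\<close> by \<open>P - 3 * u * w\<close>.  Both sides then become polynomials in
  \<open>u, w, P, Q\<close>, which coincide for \<open>k \<le> 5\<close> and agree modulo the third assumption for \<open>k = 7\<close>.
\<close>
lemma odd_power_sums_eq:
  fixes u w x y x' y' :: "'a::comm_ring_1"
  assumes x': "x'^2 = y^2 + 3 * u * w"
    and y': "y'^2 = x^2 - 3 * u * w"
    and quad: "2 * (x^2 + y^2) = 5 * (u^2 + w^2)"
    and k: "k \<in> {1, 3, 5, 7}"
  shows "((u + x)^k + (u - x)^k) + ((u + w + y)^k + (u + w - y)^k) + ((w + x)^k + (w - x)^k)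
       = ((u + x')^k + (u - x')^k) + ((u + w + y')^k + (u + w - y')^k) + ((w + x')^k + (w - x')^k)"
    (is "?lhs = ?rhs")
proof -
  define P Q where "P = x^2" and "Q = y^2"
  note squares = x' y' P_def[symmetric] Q_def[symmetric]
  consider "k = 1" | "k = 3" | "k = 5" | "k = 7"
    using k by blast
  then show ?thesis
  proof cases
    case 1
    then show ?thesis by simp
  next
    case 2
    show ?thesis
      unfolding 2 plus_minus_odd_powers squares by (simp add: algebra_simps)
  next
    case 3
    show ?thesis
      unfolding 3 plus_minus_odd_powers squares by (simp add: algebra_simps eval_nat_numeral)
  next
    case 4
    have "?lhs - ?rhs = 42 * u * w * (u + w) * (P - Q - 3 * u * w)
        * (5 * (u^2 + w^2) - 2 * (P + Q))"
      unfolding 4 plus_minus_odd_powers squares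
      by (simp add: algebra_simps eval_nat_numeral)
    also have "\<dots> = 0"
      using quad unfolding squares by simp
    finally show ?thesis by simp
  qed
qed

theorem mainTheorem7:
  fixes a b c d p q :: int and k :: nat
  assumes "(4 * q^2 - p^2) * b^2 + (4 * p^2 - q^2) * a^2 = 15 * c^2"
    and "(4 * p^2 - q^2) * b^2 + (4 * q^2 - p^2) * a^2 = 15 * d^2"
    and "k \<in> {1, 3, 5, 7}"
  shows "(- c + d + a * p - b * q)^k + (- c + d - a * p + b * q)^k
       + (- 2 * c - b * p - a * q)^k + (- 2 * c + b * p + a * q)^k
       + (- c - d - a * p + b * q)^k + (- c - d + a * p - b * q)^k
       = (- c + d + a * p + b * q)^k + (- c + d - a * p - b * q)^k
       + (- 2 * c - b * p + a * q)^k + (- 2 * c + b * p - a * q)^k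
       + (- c - d - a * p - b * q)^k + (- c - d + a * p + b * q)^k"
proof -
  let ?u = "d - c" and ?w = "- c - d"
  have "5 * ((a^2 - b^2) * (p^2 - q^2)) = 5 * (3 * (?u * ?w))"
    using assms(1,2) by algebra
  then have diff: "(a^2 - b^2) * (p^2 - q^2) = 3 * (?u * ?w)"
    by simp
  have "3 * ((a^2 + b^2) * (p^2 + q^2)) = 3 * (5 * (c^2 + d^2))"
    using assms(1,2) by algebra
  then have sum: "(a^2 + b^2) * (p^2 + q^2) = 5 * (c^2 + d^2)"
    by simp
  have x': "(a * p + b * q)^2 = (b * p + a * q)^2 + 3 * ?u * ?w"
    using diff by algebra
  have y': "(b * p - a * q)^2 = (a * p - b * q)^2 - 3 * ?u * ?w"
    using diff by algebra
  have quad: "2 * ((a * p - b * q)^2 + (b * p + a * q)^2) = 5 * (?u^2 + ?w^2)"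
    using sum by algebra
  show ?thesis
    using odd_power_sums_eq[OF x' y' quad assms(3)]
    by (simp add: algebra_simps)
qed

end
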